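(* Let $H\in W^{1,\infty}(\mathbb R)$ and let $U_0\in L^\infty_{\rm loc}(\mathbb R)$ be piecewise continuous in $\mathbb R$ with a finite set of discontinuities $\mathcal J=\{x_1,\dots,x_p\}$. Let $$(H^* )_\pm:=\limsup_{\xi\to\pm\infty}H(\xi),\qquad(H_* )_\pm:=\liminf_{\xi\to\pm\infty}H(\xi),$$ and let $U$ be the unique global viscosity solution of the Cauchy problem $U_t+H(U_x)=0$ in $\mathbb R\times\mathbb R^+$, $U=U_0$ in $\mathbb R\times\{0\}$. For $x_j\in\mathcal J$ let $J_0(x_j):=U_0(x_j^+)-U_0(x_j^-)$, $J_t(x_j):=U(x_j^+,t)-U(x_j^-,t)$ for $t>0$, and let $\tau_j:=\sup\{t>0: J_t(x_j)\ne0\}\in(0,+\infty]$ be the waiting time at $x_j$. Then $$\tau_j\le\begin{cases}\dfrac{J_0(x_j)}{(H^* )_+-(H_* )_+}&\text{if }J_0(x_j)>0\text{ and }(H^* )_+>(H_* )_+,\\[2ex]\dfrac{|J_0(x_j)|}{(H^* )_--(H_* )_-}&\text{if }J_0(x_j)<0\text{ and }(H^* )_->(H_* )_-.\end{cases}$$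
   Context: **Piecewise continuity.** $f\in L^\infty(a,b)$, $(a,b)$ bounded, is piecewise continuous if there are points $a=x_0<x_1<\dots<x_p<x_{p+1}=b$ such that each restriction $f_j$ of $f$ to $I_j=(x_{j-1},x_j)$ has a representative in $C(\overline{I}_j)$ (again denoted $f_j$), and $f_j(x_j)\ne f_{j+1}(x_j)$ for $j=1,\dots,p$. $f\in L^\infty_{\rm loc}(\mathbb R)$ is piecewise continuous in $\mathbb R$ if it is so in every bounded interval. $U_0(x_j^\pm)$ are the one-sided limits of these representatives. **Viscosity solutions.** For a locally bounded measurable $g$ on $Q=\mathbb R\times(0,T)$, $g^*$ and $g_*$ are the essential upper and lower semicontinuous envelopes on $\overline Q$: $g^*(x_0,t_0)=\lim_{\delta\to0^+}{\rm ess\,sup}_{B_\delta(x_0,t_0)\cap Q}g$, and $g_*$ with ess inf; similarly for functions on $\mathbb R$. $U\in L^\infty_{\rm loc}(\overline Q)$ is a viscosity solution of $U_t+H(U_x)=0$ in $Q$ if for all $\varphi\in C^1(Q)$: $\varphi_t+H(\varphi_x)\le0$ at local maximum points of $U^*-\varphi$ in $Q$ and $\varphi_t+H(\varphi_x)\ge0$ at local minimum points of $U_*-\varphi$ in $Q$; it solves the Cauchy problem with initial data $U_0$ if moreover $U^*(\cdot,0)=(U_0)^*$ and $U_*(\cdot,0)=(U_0)_*$ in $\mathbb R$. It is a global viscosity solution if this holds for all $T>0$. **Known facts fixing notation.** For every $U_0\in L^\infty_{\rm loc}(\mathbb R)$ which is piecewise continuous in $\mathbb R$ with a finite set of discontinuities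 $\mathcal J=\{x_1,\dots,x_p\}$, $x_1<\dots<x_p$, there is a unique global viscosity solution. With $x_0=-\infty$, $x_{p+1}=\infty$ and $S_j=(x_{j-1},x_j)\times\mathbb R^+$ ($j=1,\dots,p+1$), the restriction of $U$ to $S_j$ has a continuous representative $\tilde U_j$ in $\overline{S_j}$; $U(x_j^-,t):=\tilde U_j(x_j,t)$, $U(x_j^+,t):=\tilde U_{j+1}(x_j,t)$; and there is a unique $\tau_j\in(0,\infty]$ such that $\tilde U_j(x_j,t)\ne\tilde U_{j+1}(x_j,t)$ if and only if $t\in[0,\tau_j)$. *)

theory Defs
  imports "HOL-Analysis.Analysis" "HOL-Probability.Essential_Supremum"
begin

section \<open>Function spaces\<close>

text \<open>Elements of Lebesgue and Sobolev spaces are represented by pointwise defined functions;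
  only their values up to null sets inside the indicated domain are constrained.\<close>

definition Linfty :: "'a::euclidean_space set \<Rightarrow> ('a \<Rightarrow> real) \<Rightarrow> bool" where
  "Linfty D f \<longleftrightarrow> f \<in> borel_measurable (lebesgue_on D) \<and>
     (\<exists>C. AE z in lebesgue_on D. \<bar>f z\<bar> \<le> C)"

definition Linfty_loc :: "'a::euclidean_space set \<Rightarrow> ('a \<Rightarrow> real) \<Rightarrow> bool" where
  "Linfty_loc D f \<longleftrightarrow> f \<in> borel_measurable (lebesgue_on D) \<and>
     (\<forall>K. compact K \<and> K \<subseteq> D \<longrightarrow> Linfty K f)"

definition test_function :: "(real \<Rightarrow> real) \<Rightarrow> bool" where
  "test_function \<psi> \<longleftrightarrow> (\<forall>n x. (deriv ^^ n) \<psi> field_differentiable at x) \<and>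
     compact (closure {x. \<psi> x \<noteq> 0})"

definition weak_derivative :: "(real \<Rightarrow> real) \<Rightarrow> (real \<Rightarrow> real) \<Rightarrow> bool" where
  "weak_derivative f g \<longleftrightarrow> (\<forall>\<psi>. test_function \<psi> \<longrightarrow>
     (LINT x|lebesgue. f x * deriv \<psi> x) = - (LINT x|lebesgue. g x * \<psi> x))"

definition W1infty :: "(real \<Rightarrow> real) \<Rightarrow> bool" where
  "W1infty f \<longleftrightarrow> Linfty UNIV f \<and> (\<exists>g. Linfty UNIV g \<and> weak_derivative f g)"

section \<open>Piecewise continuity\<close>

text \<open>\<open>g j\<close> is the continuous representative of \<open>f\<close> on the \<open>j\<close>-th subinterval
  \<open>(x (j - 1), x j)\<close>, for \<open>j = 1, \<dots>, p + 1\<close>; the interior points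
  \<open>x 1, \<dots>, x p\<close> are genuine jumps.\<close>

definition pc_partition ::
  "(real \<Rightarrow> real) \<Rightarrow> real \<Rightarrow> real \<Rightarrow> nat \<Rightarrow> (nat \<Rightarrow> real) \<Rightarrow> (nat \<Rightarrow> real \<Rightarrow> real) \<Rightarrow> bool" where
  "pc_partition f a b p x g \<longleftrightarrow>
     x 0 = a \<and> x (p + 1) = b \<and> (\<forall>j\<in>{1..p + 1}. x (j - 1) < x j) \<and>
     (\<forall>j\<in>{1..p + 1}. continuous_on {x (j - 1)..x j} (g j) \<and>
        (AE y in lebesgue_on {x (j - 1)<..<x j}. f y = g j y)) \<and>
     (\<forall>j\<in>{1..p}. g j (x j) \<noteq> g (j + 1) (x j))"

definition piecewise_continuous_on :: "real \<Rightarrow> real \<Rightarrow> (real \<Rightarrow> real) \<Rightarrow> bool" where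
  "piecewise_continuous_on a b f \<longleftrightarrow>
     Linfty {a<..<b} f \<and> (\<exists>p x g. pc_partition f a b p x g)"

definition piecewise_continuous :: "(real \<Rightarrow> real) \<Rightarrow> bool" where
  "piecewise_continuous f \<longleftrightarrow> (\<forall>a b. a < b \<longrightarrow> piecewise_continuous_on a b f)"

definition discontinuities :: "(real \<Rightarrow> real) \<Rightarrow> real set" where
  "discontinuities f = {y. \<exists>a b p x g. pc_partition f a b p x g \<and> (\<exists>j\<in>{1..p}. y = x j)}"

text \<open>The limits are taken along the continuous representatives, since \<open>f\<close> itself may be
  changed on null sets. Both values are uniquely determined when \<open>y \<in> discontinuities f\<close>
  and are used only there.\<close>

definition limit_left :: "(real \<Rightarrow> real) \<Rightarrow> real \<Rightarrow> real" where
  "limit_left f y = (THE v. \<exists>a b p x g. pc_partition f a b p x g \<and>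
     (\<exists>j\<in>{1..p}. y = x j \<and> (g j \<longlongrightarrow> v) (at_left y)))"

definition limit_right :: "(real \<Rightarrow> real) \<Rightarrow> real \<Rightarrow> real" where
  "limit_right f y = (THE v. \<exists>a b p x g. pc_partition f a b p x g \<and>
     (\<exists>j\<in>{1..p}. y = x j \<and> (g (j + 1) \<longlongrightarrow> v) (at_right y)))"

section \<open>Semicontinuous envelopes\<close>

text \<open>The limits are formed in the extended reals; for locally bounded functions and
  \<open>z\<close> in the closure of the domain they are finite, and the conversion to \<open>real\<close> loses
  nothing.\<close>

definition upper_envelope ::
  "'a::euclidean_space set \<Rightarrow> ('a \<Rightarrow> real) \<Rightarrow> 'a \<Rightarrow> real" where
  "upper_envelope D f z = real_of_ereal
     (Lim (at_right 0) (\<lambda>\<delta>. esssup (lebesgue_on (ball z \<delta> \<inter> D)) (\<lambda>w. ereal (f w))))"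

text \<open>The essential infimum is minus the essential supremum of the negative.\<close>

definition lower_envelope ::
  "'a::euclidean_space set \<Rightarrow> ('a \<Rightarrow> real) \<Rightarrow> 'a \<Rightarrow> real" where
  "lower_envelope D f z = real_of_ereal
     (Lim (at_right 0) (\<lambda>\<delta>. - esssup (lebesgue_on (ball z \<delta> \<inter> D)) (\<lambda>w. - ereal (f w))))"

section \<open>Viscosity solutions\<close>

text \<open>Points of space-time are pairs \<open>(x, t)\<close>.\<close>

definition domain_Q :: "real \<Rightarrow> (real \<times> real) set" where
  "domain_Q T = UNIV \<times> {0<..<T}"

text \<open>\<open>\<phi> \<in> C\<^sup>1(Q)\<close> with partial derivatives \<open>\<phi>\<^sub>x\<close> and \<open>\<phi>\<^sub>t\<close>, for open \<open>Q\<close>.\<close>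

definition C1_with_partials ::
  "(real \<times> real) set \<Rightarrow> (real \<times> real \<Rightarrow> real) \<Rightarrow> (real \<times> real \<Rightarrow> real) \<Rightarrow> (real \<times> real \<Rightarrow> real) \<Rightarrow> bool"
  where
  "C1_with_partials Q \<phi> \<phi>\<^sub>x \<phi>\<^sub>t \<longleftrightarrow>
     continuous_on Q \<phi>\<^sub>x \<and> continuous_on Q \<phi>\<^sub>t \<and>
     (\<forall>z\<in>Q. (\<phi> has_derivative (\<lambda>(h, k). \<phi>\<^sub>x z * h + \<phi>\<^sub>t z * k)) (at z))"

definition local_max_in :: "'a::metric_space set \<Rightarrow> ('a \<Rightarrow> real) \<Rightarrow> 'a \<Rightarrow> bool" where
  "local_max_in D f z \<longleftrightarrow> z \<in> D \<and> (\<exists>\<epsilon>>0. \<forall>w\<in>ball z \<epsilon> \<inter> D. f w \<le> f z)"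

definition local_min_in :: "'a::metric_space set \<Rightarrow> ('a \<Rightarrow> real) \<Rightarrow> 'a \<Rightarrow> bool" where
  "local_min_in D f z \<longleftrightarrow> z \<in> D \<and> (\<exists>\<epsilon>>0. \<forall>w\<in>ball z \<epsilon> \<inter> D. f z \<le> f w)"

definition viscosity_solution ::
  "(real \<Rightarrow> real) \<Rightarrow> real \<Rightarrow> (real \<times> real \<Rightarrow> real) \<Rightarrow> bool" where
  "viscosity_solution H T U \<longleftrightarrow>
     Linfty_loc (closure (domain_Q T)) U \<and>
     (\<forall>\<phi> \<phi>\<^sub>x \<phi>\<^sub>t. C1_with_partials (domain_Q T) \<phi> \<phi>\<^sub>x \<phi>\<^sub>t \<longrightarrow>
        (\<forall>z. local_max_in (domain_Q T) (\<lambda>w. upper_envelope (domain_Q T) U w - \<phi> w) z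
           \<longrightarrow> \<phi>\<^sub>t z + H (\<phi>\<^sub>x z) \<le> 0) \<and>
        (\<forall>z. local_min_in (domain_Q T) (\<lambda>w. lower_envelope (domain_Q T) U w - \<phi> w) z
           \<longrightarrow> \<phi>\<^sub>t z + H (\<phi>\<^sub>x z) \<ge> 0))"

definition viscosity_solution_Cauchy ::
  "(real \<Rightarrow> real) \<Rightarrow> (real \<Rightarrow> real) \<Rightarrow> real \<Rightarrow> (real \<times> real \<Rightarrow> real) \<Rightarrow> bool" where
  "viscosity_solution_Cauchy H U0 T U \<longleftrightarrow>
     viscosity_solution H T U \<and>
     (\<forall>x. upper_envelope (domain_Q T) U (x, 0) = upper_envelope UNIV U0 x) \<and>
     (\<forall>x. lower_envelope (domain_Q T) U (x, 0) = lower_envelope UNIV U0 x)"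

definition global_viscosity_solution ::
  "(real \<Rightarrow> real) \<Rightarrow> (real \<Rightarrow> real) \<Rightarrow> (real \<times> real \<Rightarrow> real) \<Rightarrow> bool" where
  "global_viscosity_solution H U0 U \<longleftrightarrow> (\<forall>T>0. viscosity_solution_Cauchy H U0 T U)"

section \<open>Jumps and waiting times\<close>

text \<open>\<open>strip p x j\<close> is \<open>(x (j - 1), x j) \<times> (0, \<infinity>)\<close> for \<open>j = 1, \<dots>, p + 1\<close>, with the
  convention that \<open>x 0\<close> stands for \<open>-\<infinity>\<close> and \<open>x (p + 1)\<close> for \<open>\<infinity>\<close>, whatever the values of
  the function \<open>x\<close> there.\<close>

definition strip :: "nat \<Rightarrow> (nat \<Rightarrow> real) \<Rightarrow> nat \<Rightarrow> (real \<times> real) set" where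
  "strip p x j = {(y, t). (j \<noteq> 1 \<longrightarrow> x (j - 1) < y) \<and> (j \<noteq> p + 1 \<longrightarrow> y < x j) \<and> 0 < t}"

definition continuous_representative ::
  "'a::euclidean_space set \<Rightarrow> ('a \<Rightarrow> real) \<Rightarrow> ('a \<Rightarrow> real) \<Rightarrow> bool" where
  "continuous_representative S f g \<longleftrightarrow>
     continuous_on (closure S) g \<and> (AE z in lebesgue_on S. f z = g z)"

text \<open>Here \<open>V j\<close> is the continuous representative of the solution on the closure of the
  \<open>j\<close>-th strip, so that the two terms are the traces from the right and from the left at
  \<open>x j\<close>.\<close>

definition jump :: "(nat \<Rightarrow> real \<times> real \<Rightarrow> real) \<Rightarrow> (nat \<Rightarrow> real) \<Rightarrow> nat \<Rightarrow> real \<Rightarrow> real" where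
  "jump V x j t = V (j + 1) (x j, t) - V j (x j, t)"

definition waiting_time :: "(nat \<Rightarrow> real \<times> real \<Rightarrow> real) \<Rightarrow> (nat \<Rightarrow> real) \<Rightarrow> nat \<Rightarrow> ereal" where
  "waiting_time V x j = Sup (ereal ` {t. 0 < t \<and> jump V x j t \<noteq> 0})"

definition initial_jump :: "(real \<Rightarrow> real) \<Rightarrow> real \<Rightarrow> real" where
  "initial_jump U0 y = limit_right U0 y - limit_left U0 y"

end

theory Submission
  imports Defs
begin

text \<open>Fix a jump point \<open>c\<close> and suppose that on a time interval the solution is larger on the right of
  \<open>c\<close> than on the left. On the line \<open>x = c\<close> the upper envelope of \<open>U\<close> is then the right trace.
  A test function \<open>\<xi> (x - c) + \<psi> t\<close> with a very large slope \<open>\<xi>\<close> can touch the upper envelope from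
  above there: to the right the slope forces the maximum towards \<open>c\<close>, and to the left the
  gap between the two traces keeps the envelope strictly below. The subsolution inequality then reads
  \<open>\<psi>' + H \<xi> \<le> 0\<close>, and since \<open>\<xi>\<close> may be chosen arbitrarily large with \<open>H \<xi>\<close> close to its upper limit, the
  right trace decreases at least at the rate \<open>limsup H\<close> at \<open>+\<infinity>\<close>. This is
  \<open>steep_barrier_decay\<close>, carried over to solutions in \<open>larger_trace_decay\<close>.

  The other estimates come from the symmetries of the equation: \<open>- U\<close> is governed by
  \<open>- H (- \<xi>)\<close>, and the reflection \<open>x \<mapsto> - x\<close> replaces \<open>H \<xi>\<close> by \<open>H (- \<xi>)\<close>. Applied to the
  smaller trace they show that it decreases at most at the rate \<open>liminf H\<close> at \<open>+\<infinity>\<close>.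
  Hence the jump loses height at least at the rate \<open>limsup H - liminf H\<close> as long as it is positive, and
  a negative jump shrinks in the same way with the limits at \<open>-\<infinity>\<close> (\<open>jump_decay\<close>).

  Because these rates are never negative, a jump that has reached \<open>0\<close> can reappear with neither
  sign: its modulus would have to grow from \<open>0\<close>. So every time with a nonzero jump is connected to
  time \<open>0\<close> by an interval of nonzero jumps of the initial sign, and the initial height divided by
  the rate bounds that time (\<open>no_return_extinction_bound\<close>). It remains to identify the
  essential envelopes near \<open>c\<close> with the continuous traces, at positive times
  (\<open>envelopes_near_jump\<close>) and at time \<open>0\<close>, where they give the one-sided limits of the
  initial data (\<open>initial_jump_eq_trace_difference\<close>).\<close>

section \<open>Essential envelopes of piecewise continuous functions\<close>

lemma open_AE_notin_imp_empty:
  fixes S :: "'a::euclidean_space set"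
  assumes "open S" and "AE w in lebesgue. w \<notin> S"
  shows "S = {}"
proof -
  have "S \<in> null_sets lebesgue"
    using assms by (subst AE_iff_null_sets) auto
  then show ?thesis
    using assms(1) open_not_negligible negligible_iff_null_sets by blast
qed

text \<open>Only the approximate bounds on small balls matter: one ball suffices from above, since
  the essential suprema shrink with the radius, but every ball must be checked from below.\<close>

lemma esssup_ball_tendsto:
  fixes D :: "'a::euclidean_space set"
  assumes f: "f \<in> borel_measurable (lebesgue_on D)" and D: "open D"
    and up: "\<And>e. e > 0 \<Longrightarrow> \<exists>\<delta>>0. AE w in lebesgue. w \<in> ball z \<delta> \<inter> D \<longrightarrow> f w \<le> M + e"
    and low: "\<And>e \<delta>. e > 0 \<Longrightarrow> \<delta> > 0 \<Longrightarrow>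
      \<not> (AE w in lebesgue. w \<in> ball z \<delta> \<inter> D \<longrightarrow> f w \<le> M - e)"
  shows "((\<lambda>\<delta>. esssup (lebesgue_on (ball z \<delta> \<inter> D)) (\<lambda>w. ereal (f w))) \<longlongrightarrow> ereal M) (at_right 0)"
proof -
  define F where "F = (\<lambda>\<delta>. esssup (lebesgue_on (ball z \<delta> \<inter> D)) (\<lambda>w. ereal (f w)))"
  have op: "ball z \<delta> \<inter> D \<in> sets lebesgue" for \<delta>
    using D by (auto intro: borel_open)
  have AEiff: "(AE w in lebesgue_on (ball z \<delta> \<inter> D). P w) \<longleftrightarrow>
      (AE w in lebesgue. w \<in> ball z \<delta> \<inter> D \<longrightarrow> P w)" for P \<delta>
    by (rule AE_restrict_space_iff) (use op in auto)
  have meas: "(\<lambda>w. ereal (f w)) \<in> borel_measurable (lebesgue_on (ball z \<delta> \<inter> D))" for \<delta>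
    by (intro borel_measurable_ereal measurable_restrict_mono[OF f]) auto
  have le: "eventually (\<lambda>\<delta>. F \<delta> \<le> ereal (M + e)) (at_right 0)" if "e > 0" for e
  proof -
    obtain \<delta>0 where "\<delta>0 > 0" and \<delta>0: "AE w in lebesgue. w \<in> ball z \<delta>0 \<inter> D \<longrightarrow> f w \<le> M + e"
      using up[OF \<open>e > 0\<close>] by auto
    have "F \<delta> \<le> ereal (M + e)" if "0 < \<delta>" "\<delta> < \<delta>0" for \<delta>
      unfolding F_def
    proof (rule esssup_I[OF meas], subst AEiff)
      show "AE w in lebesgue. w \<in> ball z \<delta> \<inter> D \<longrightarrow> ereal (f w) \<le> ereal (M + e)"
        using \<delta>0 by eventually_elim (use that in auto)
    qed
    then show ?thesis
      using \<open>\<delta>0 > 0\<close> unfolding eventually_at_right_field by blast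
  qed
  have ge: "ereal (M - e) < F \<delta>" if "e > 0" "\<delta> > 0" for e \<delta>
  proof (rule ccontr)
    assume "\<not> ereal (M - e) < F \<delta>"
    then have "F \<delta> \<le> ereal (M - e)" by simp
    moreover have "AE w in lebesgue. w \<in> ball z \<delta> \<inter> D \<longrightarrow> ereal (f w) \<le> F \<delta>"
      using esssup_AE[of "\<lambda>w. ereal (f w)" "lebesgue_on (ball z \<delta> \<inter> D)"]
      unfolding AEiff F_def .
    ultimately have "AE w in lebesgue. w \<in> ball z \<delta> \<inter> D \<longrightarrow> ereal (f w) \<le> ereal (M - e)"
      by (auto elim!: eventually_mono dest: order_trans simp del: ereal_less_eq)
    then show False using low[OF that] by simp
  qed
  have "(F \<longlongrightarrow> ereal M) (at_right 0)"
  proof (rule order_tendstoI)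
    fix a assume a: "a < ereal M"
    obtain e where e: "e > 0" "a \<le> ereal (M - e)"
    proof (cases a)
      case (real q)
      then show ?thesis using a by (intro that[of "M - q"]) auto
    qed (use a in \<open>auto intro: that[of 1]\<close>)
    have "\<And>\<delta>. 0 < \<delta> \<Longrightarrow> a < F \<delta>" using ge[OF e(1)] e(2) by (meson le_less_trans)
    then show "eventually (\<lambda>\<delta>. a < F \<delta>) (at_right 0)"
      unfolding eventually_at_right_field by (intro exI[of _ 1]) auto
  next
    fix a assume a: "ereal M < a"
    obtain e where e: "e > 0" "ereal (M + e) < a"
    proof (cases a)
      case (real q)
      then show ?thesis using a by (intro that[of "(q - M) / 2"]) (auto simp: field_simps)
    qed (use a in \<open>auto intro: that[of 1]\<close>)
    show "eventually (\<lambda>\<delta>. F \<delta> < a) (at_right 0)"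
      using le[OF e(1)] by eventually_elim (use e in auto)
  qed
  then show ?thesis unfolding F_def .
qed

text \<open>A continuous representative on an open set attains its boundary values, up to \<open>\<epsilon>\<close>, on open and
  hence non-null sets near \<open>z\<close>, so each piece contributes exactly its value at \<open>z\<close>. The uncovered
  remainder is null and contributes nothing.\<close>

lemma esssup_ball_tendsto_two_pieces:
  fixes D A B :: "'a::euclidean_space set"
  assumes f: "f \<in> borel_measurable (lebesgue_on D)" and D: "open D"
    and A: "open A" "A \<subseteq> D" "z \<in> closure A" "continuous_on (closure A) g"
      "AE w in lebesgue. w \<in> A \<longrightarrow> f w = g w"
    and B: "open B" "B \<subseteq> D" "z \<in> closure B" "continuous_on (closure B) h"
      "AE w in lebesgue. w \<in> B \<longrightarrow> f w = h w"
    and \<rho>: "\<rho> > 0" and cover: "negligible (ball z \<rho> \<inter> D - (A \<union> B))"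
  shows "((\<lambda>\<delta>. esssup (lebesgue_on (ball z \<delta> \<inter> D)) (\<lambda>w. ereal (f w)))
    \<longlongrightarrow> ereal (max (g z) (h z))) (at_right 0)"
proof (rule esssup_ball_tendsto[OF f D])
  fix e :: real assume e: "e > 0"
  obtain d1 where d1: "d1 > 0" "\<And>w. w \<in> closure A \<Longrightarrow> dist w z < d1 \<Longrightarrow> dist (g w) (g z) < e"
    using A(3,4) e unfolding continuous_on_iff by meson
  obtain d2 where d2: "d2 > 0" "\<And>w. w \<in> closure B \<Longrightarrow> dist w z < d2 \<Longrightarrow> dist (h w) (h z) < e"
    using B(3,4) e unfolding continuous_on_iff by meson
  have "AE w in lebesgue. w \<notin> ball z \<rho> \<inter> D - (A \<union> B)"
    using cover unfolding negligible_iff_null_sets by (rule AE_not_in)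
  with A(5) B(5)
  have "AE w in lebesgue. w \<in> ball z (min \<rho> (min d1 d2)) \<inter> D \<longrightarrow> f w \<le> max (g z) (h z) + e"
  proof eventually_elim
    case (elim w)
    show ?case
    proof
      assume w: "w \<in> ball z (min \<rho> (min d1 d2)) \<inter> D"
      then consider "w \<in> A" | "w \<in> B" using elim by auto
      then show "f w \<le> max (g z) (h z) + e"
      proof cases
        case 1
        then have "dist (g w) (g z) < e"
          using w closure_subset[of A] by (intro d1(2)) (auto simp: dist_commute)
        then show ?thesis using elim 1 by (auto simp: dist_real_def)
      next
        case 2
        then have "dist (h w) (h z) < e"
          using w closure_subset[of B] by (intro d2(2)) (auto simp: dist_commute)
        then show ?thesis using elim 2 by (auto simp: dist_real_def)
      qed
    qed
  qed
  then show "\<exists>\<delta>>0. AE w in lebesgue. w \<in> ball z \<delta> \<inter> D \<longrightarrow> f w \<le> max (g z) (h z) + e"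
    using \<rho> d1(1) d2(1) by (intro exI[of _ "min \<rho> (min d1 d2)"]) auto
next
  fix e \<delta> :: real assume e: "e > 0" "\<delta> > 0"
  have no: "\<not> (AE w in lebesgue. w \<in> ball z \<delta> \<inter> D \<longrightarrow> f w \<le> k z - e)"
    if C: "open C" "C \<subseteq> D" "z \<in> closure C" "continuous_on (closure C) k"
      "AE w in lebesgue. w \<in> C \<longrightarrow> f w = k w" for C k
  proof
    assume *: "AE w in lebesgue. w \<in> ball z \<delta> \<inter> D \<longrightarrow> f w \<le> k z - e"
    obtain d where d: "d > 0" "\<And>w. w \<in> closure C \<Longrightarrow> dist w z < d \<Longrightarrow> dist (k w) (k z) < e"
      using C(3,4) e unfolding continuous_on_iff by meson
    have "AE w in lebesgue. w \<notin> C \<inter> ball z (min d \<delta>)"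
      using * C(5)
    proof eventually_elim
      case (elim w)
      show ?case
      proof
        assume w: "w \<in> C \<inter> ball z (min d \<delta>)"
        then have "dist (k w) (k z) < e"
          using closure_subset[of C] by (intro d(2)) (auto simp: dist_commute)
        then show False using elim w C(2) by (auto simp: dist_real_def)
      qed
    qed
    then have "C \<inter> ball z (min d \<delta>) = {}"
      by (intro open_AE_notin_imp_empty) (use C in auto)
    moreover have "C \<inter> ball z (min d \<delta>) \<noteq> {}"
      using C(3) d(1) e(2) unfolding closure_approachable
      by (metis IntI dist_commute empty_iff mem_ball min_less_iff_conj)
    ultimately show False by simp
  qed
  show "\<not> (AE w in lebesgue. w \<in> ball z \<delta> \<inter> D \<longrightarrow> f w \<le> max (g z) (h z) - e)"
    using no[OF A] no[OF B] by (cases "g z \<le> h z") (simp_all add: max_def)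
qed


text \<open>Taking the two pieces equal treats points at which \<open>f\<close> has a single continuous representative.\<close>

lemma envelopes_two_pieces:
  fixes D A B :: "'a::euclidean_space set"
  assumes f: "f \<in> borel_measurable (lebesgue_on D)" and D: "open D"
    and A: "open A" "A \<subseteq> D" "z \<in> closure A" "continuous_on (closure A) g"
      "AE w in lebesgue. w \<in> A \<longrightarrow> f w = g w"
    and B: "open B" "B \<subseteq> D" "z \<in> closure B" "continuous_on (closure B) h"
      "AE w in lebesgue. w \<in> B \<longrightarrow> f w = h w"
    and \<rho>: "\<rho> > 0" and cover: "negligible (ball z \<rho> \<inter> D - (A \<union> B))"
  shows "upper_envelope D f z = max (g z) (h z)"
    and "lower_envelope D f z = min (g z) (h z)"
proof -
  show "upper_envelope D f z = max (g z) (h z)"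
    unfolding upper_envelope_def
    by (subst tendsto_Lim[OF _ esssup_ball_tendsto_two_pieces[OF assms]]) (auto simp: max_def)
  have "((\<lambda>\<delta>. esssup (lebesgue_on (ball z \<delta> \<inter> D)) (\<lambda>w. ereal (- f w)))
      \<longlongrightarrow> ereal (max (- g z) (- h z))) (at_right 0)"
    by (rule esssup_ball_tendsto_two_pieces[OF _ D A(1-3) _ _ B(1-3) _ _ \<rho> cover])
      (use A(4,5) B(4,5) f in \<open>auto intro: continuous_intros\<close>)
  then have "((\<lambda>\<delta>. - esssup (lebesgue_on (ball z \<delta> \<inter> D)) (\<lambda>w. - ereal (f w)))
      \<longlongrightarrow> - ereal (max (- g z) (- h z))) (at_right 0)"
    by (simp add: ereal_Lim_uminus[symmetric])
  then show "lower_envelope D f z = min (g z) (h z)"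
    unfolding lower_envelope_def
    by (subst tendsto_Lim) (auto simp: max_def min_def)
qed

section \<open>The steep barrier\<close>

text \<open>The barrier argument in coordinates that put the jump at \<open>y = 0\<close> and the larger trace \<open>v\<close> at
  \<open>y \<ge> 0\<close>. If the trace exceeded the claimed bound at time \<open>\<tau>\<close>, the function
  \<open>v - \<xi> y + A t - \<sigma> / (b - t)\<close> would have a maximum over the right half of the box
  that lies neither at the initial time (\<open>\<sigma>\<close> is small), nor near the final time (the barrier blows up),
  nor away from \<open>y = 0\<close> (\<open>\<xi>\<close> is large). By the gap it is also a local maximum from the left, so that
  the subsolution inequality gives \<open>\<sigma> / (b - t)\<^sup>2 - A + G \<xi> \<le> 0\<close>, contradicting \<open>A \<le> G \<xi>\<close>.
  The gap concerns times strictly between \<open>a\<close> and \<open>b\<close>, so that \<open>a\<close> can be a time at which the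
  jump vanishes.\<close>

lemma steep_barrier_decay:
  fixes v l W :: "real \<times> real \<Rightarrow> real"
  assumes r: "0 < r" and \<tau>: "a < \<tau>" "\<tau> < b"
    and v: "continuous_on ({0..r} \<times> {a..b}) v"
    and l: "continuous_on ({-r..0} \<times> {a..b}) l"
    and gap: "\<And>t. a < t \<Longrightarrow> t < b \<Longrightarrow> l (0, t) < v (0, t)"
    and W: "\<And>y t. W (y, t) = (if y < 0 then l (y, t) else v (y, t))"
    and sub: "\<And>\<xi> \<psi> \<psi>' y t. \<lbrakk>0 \<le> y; y < r; a < t; t < b;
        \<And>s. s < b \<Longrightarrow> (\<psi> has_real_derivative \<psi>' s) (at s); continuous_on {..<b} \<psi>';
        eventually (\<lambda>w. W w - \<xi> * fst w - \<psi> (snd w) \<le> W (y, t) - \<xi> * y - \<psi> t) (nhds (y, t))\<rbrakk>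
        \<Longrightarrow> \<psi>' t + G \<xi> \<le> 0"
    and freq: "\<And>N. \<exists>\<xi>>N. A \<le> G \<xi>"
  shows "v (0, \<tau>) \<le> v (0, a) - A * (\<tau> - a)"
proof (rule ccontr)
  define f where "f t = v (0, t) + A * t" for t
  assume "\<not> ?thesis"
  then have f: "f a < f \<tau>" by (simp add: f_def algebra_simps)
  \<comment> \<open>With this \<open>\<sigma>\<close> the penalised value at \<open>\<tau>\<close> is the mean \<open>m\<close> of \<open>f a\<close> and \<open>f \<tau>\<close>, still above \<open>f a\<close>.\<close>
  define \<sigma> where "\<sigma> = (f \<tau> - f a) * (b - \<tau>) / 2"
  define m where "m = (f \<tau> + f a) / 2"
  have \<sigma>: "\<sigma> > 0" using f \<tau> by (simp add: \<sigma>_def)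
  have m_eq: "f \<tau> - \<sigma> / (b - \<tau>) = m" using \<tau> by (simp add: \<sigma>_def m_def field_simps)
  have m: "f a < m" using f by (simp add: m_def)
  define g where "g w = v w + A * snd w" for w :: "real \<times> real"
  have g_cont: "continuous_on ({0..r} \<times> {a..b}) g"
    unfolding g_def by (intro continuous_intros v)
  have "bounded (g ` ({0..r} \<times> {a..b}))"
    by (intro compact_imp_bounded compact_continuous_image g_cont compact_Times) auto
  then obtain M where M: "\<And>w. w \<in> {0..r} \<times> {a..b} \<Longrightarrow> \<bar>g w\<bar> \<le> M"
    unfolding bounded_iff by auto
  have M\<tau>: "f \<tau> \<le> M" "0 \<le> M" using M[of "(0, \<tau>)"] r \<tau> by (auto simp: g_def f_def)
  \<comment> \<open>At time \<open>b - \<kappa>\<close> the barrier alone pushes every value below \<open>m\<close>, so the maximum can be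
    taken over a compact box that avoids the singular time \<open>b\<close>.\<close>
  define \<kappa> where "\<kappa> = \<sigma> / (M + \<bar>m\<bar> + 1)"
  have \<kappa>: "\<kappa> > 0" using \<sigma> M\<tau> by (simp add: \<kappa>_def)
  have \<sigma>\<kappa>: "\<sigma> / \<kappa> = M + \<bar>m\<bar> + 1" using \<sigma> M\<tau> by (simp add: \<kappa>_def)
  have \<kappa>b: "\<kappa> < b - \<tau>"
  proof -
    have "\<sigma> / (b - \<tau>) < \<sigma> / \<kappa>" using m_eq \<sigma>\<kappa> M\<tau> by linarith
    moreover have "\<sigma> / \<kappa> \<le> \<sigma> / (b - \<tau>)" if "b - \<tau> \<le> \<kappa>"
      by (rule divide_left_mono) (use that \<sigma> \<kappa> \<tau> in auto)
    ultimately show ?thesis by (meson not_le)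
  qed
  have "(0, a) \<in> {0..r} \<times> {a..b}" "0 < m - f a" using r \<tau> m by auto
  then obtain d where d: "d > 0"
    "\<And>w. w \<in> {0..r} \<times> {a..b} \<Longrightarrow> dist w (0, a) < d \<Longrightarrow> dist (g w) (g (0, a)) < m - f a"
    using g_cont unfolding continuous_on_iff by meson
  define \<rho> where "\<rho> = min d r"
  have \<rho>: "\<rho> > 0" using d(1) r by (simp add: \<rho>_def)
  have near_a: "g (y, a) < m" if "0 \<le> y" "y < \<rho>" for y
    using d(2)[of "(y, a)"] that \<tau> by (auto simp: \<rho>_def dist_Pair_Pair dist_real_def g_def f_def)
  \<comment> \<open>The slope costs more than \<open>M + \<bar>m\<bar> + 1\<close> as soon as \<open>y \<ge> \<rho>\<close>.\<close>
  obtain \<xi> where \<xi>: "\<xi> > (M + \<bar>m\<bar> + 1) / \<rho>" "A \<le> G \<xi>" using freq by blast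
  have "0 \<le> (M + \<bar>m\<bar> + 1) / \<rho>" using \<rho> M\<tau> by simp
  then have \<xi>0: "\<xi> > 0" using \<xi>(1) by (rule le_less_trans)
  have \<xi>\<rho>: "\<xi> * \<rho> > M + \<bar>m\<bar> + 1" using \<xi>(1) \<rho> by (simp add: field_simps)
  define \<psi> where "\<psi> t = \<sigma> / (b - t) - A * t" for t
  define \<psi>' where "\<psi>' t = \<sigma> / (b - t)\<^sup>2 - A" for t
  define \<Phi> where "\<Phi> w = v w - \<xi> * fst w - \<psi> (snd w)" for w
  define K where "K = {0..r} \<times> {a..b - \<kappa>}"
  have \<Phi>_eq: "\<Phi> w = g w - \<xi> * fst w - \<sigma> / (b - snd w)" for w
    by (simp add: \<Phi>_def g_def \<psi>_def)
  have \<psi>_cont: "continuous_on (S \<times> {a..b - \<kappa>}) (\<lambda>w. \<psi> (snd w))" for S :: "real set"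
    unfolding \<psi>_def using \<kappa> by (auto intro!: continuous_intros)
  have "continuous_on K \<Phi>"
    unfolding \<Phi>_def K_def
    by (intro continuous_intros \<psi>_cont continuous_on_subset[OF v]) (use \<kappa> in auto)
  moreover have "compact K" "K \<noteq> {}" using r \<tau> \<kappa>b by (auto simp: K_def intro!: compact_Times)
  ultimately obtain z where z: "z \<in> K" and max: "\<And>w. w \<in> K \<Longrightarrow> \<Phi> w \<le> \<Phi> z"
    using continuous_attains_sup by metis
  obtain y t where zyt: "z = (y, t)" by fastforce
  have yt: "0 \<le> y" "y \<le> r" "a \<le> t" "t \<le> b - \<kappa>" using z by (auto simp: zyt K_def)
  have "m = \<Phi> (0, \<tau>)" unfolding \<Phi>_eq using m_eq by (simp add: g_def f_def)
  also have "\<dots> \<le> \<Phi> (y, t)" unfolding zyt[symmetric] using r \<tau> \<kappa>b by (intro max) (auto simp: K_def)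
  finally have low: "m \<le> \<Phi> (y, t)" .
  have gM: "g (y, t) \<le> M" using M[of "(y, t)"] yt \<kappa> by auto
  have pen: "0 \<le> \<xi> * y" "0 < \<sigma> / (b - t)" using \<xi>0 yt \<sigma> \<kappa> by auto
  have y: "y < \<rho>"
  proof (rule ccontr)
    assume "\<not> y < \<rho>"
    then have "\<xi> * \<rho> \<le> \<xi> * y" using \<xi>0 by simp
    then show False using low gM pen \<xi>\<rho> unfolding \<Phi>_eq by simp
  qed
  have t_a: "a < t"
  proof (rule ccontr)
    assume "\<not> a < t"
    then have "t = a" using yt by simp
    then show False using low near_a[of y] y yt pen unfolding \<Phi>_eq by simp
  qed
  have t_b: "t < b - \<kappa>"
  proof (rule ccontr)
    assume "\<not> t < b - \<kappa>"
    then have "\<sigma> / (b - t) = M + \<bar>m\<bar> + 1" using yt \<sigma>\<kappa> by (simp add: order_antisym)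
    then show False using low gM pen unfolding \<Phi>_eq by simp
  qed
  have "y < r" using y by (simp add: \<rho>_def)
  have "eventually (\<lambda>w. W w - \<xi> * fst w - \<psi> (snd w) \<le> W (y, t) - \<xi> * y - \<psi> t) (nhds (y, t))"
  proof -
    have "open ({-r<..<r} \<times> {a<..<b - \<kappa>})" by (intro open_Times) auto
    then have box: "eventually (\<lambda>w. w \<in> {-r<..<r} \<times> {a<..<b - \<kappa>}) (nhds (y, t))"
      by (rule eventually_nhds_in_open) (use \<open>y < r\<close> yt t_a t_b r in auto)
    \<comment> \<open>Points with \<open>y < 0\<close> are near the maximum point only if that lies on \<open>y = 0\<close>, and there the
      gap between \<open>l\<close> and \<open>v\<close> outweighs the small changes of the test function.\<close>
    have left: "eventually (\<lambda>w. w \<in> {-r<..<r} \<times> {a<..<b - \<kappa>} \<longrightarrow> fst w < 0 \<longrightarrow>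
        l w - \<xi> * fst w - \<psi> (snd w) \<le> \<Phi> (y, t)) (nhds (y, t))"
    proof (cases "y > 0")
      case True
      have "open ({0<..} \<times> UNIV :: (real \<times> real) set)" by (intro open_Times) auto
      then have "eventually (\<lambda>w. w \<in> {0<..} \<times> UNIV) (nhds (y, t))"
        by (rule eventually_nhds_in_open) (use True in auto)
      then show ?thesis by eventually_elim auto
    next
      case False
      then have [simp]: "y = 0" using yt by simp
      define F where "F w = l w - \<xi> * fst w - \<psi> (snd w)" for w
      have "continuous_on ({-r..0} \<times> {a..b - \<kappa>}) F"
        unfolding F_def
        by (intro continuous_intros \<psi>_cont continuous_on_subset[OF l]) (use \<kappa> in auto)
      moreover have "(0, t) \<in> {-r..0} \<times> {a..b - \<kappa>}" using r yt by simp
      moreover have "v (0, t) - l (0, t) > 0" using gap[of t] t_a t_b \<kappa> by simp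
      ultimately obtain e where e: "e > 0" "\<And>w. w \<in> {-r..0} \<times> {a..b - \<kappa>} \<Longrightarrow> dist w (0, t) < e \<Longrightarrow>
          dist (F w) (F (0, t)) < v (0, t) - l (0, t)"
        unfolding continuous_on_iff by meson
      have "l w - \<xi> * fst w - \<psi> (snd w) \<le> \<Phi> (y, t)"
        if "dist w (y, t) < e" "w \<in> {-r<..<r} \<times> {a<..<b - \<kappa>}" "fst w < 0" for w
        using e(2)[of w] that by (auto simp: dist_real_def \<Phi>_def F_def)
      then show ?thesis using e(1) unfolding eventually_nhds_metric by blast
    qed
    have "W (y, t) = v (y, t)" using yt by (simp add: W)
    show ?thesis using box left
    proof eventually_elim
      case (elim w)
      obtain q s where w: "w = (q, s)" by fastforce
      show ?case
      proof (cases "q < 0")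
        case True
        then show ?thesis using elim \<open>W (y, t) = v (y, t)\<close> by (simp add: w W \<Phi>_def)
      next
        case False
        then have "w \<in> K" using elim(1) by (auto simp: w K_def)
        then show ?thesis using max[of w] False \<open>W (y, t) = v (y, t)\<close>
          by (simp add: w W \<Phi>_def zyt)
      qed
    qed
  qed
  moreover have "(\<psi> has_real_derivative \<psi>' s) (at s)" if "s < b" for s
    unfolding \<psi>_def \<psi>'_def using that
    by (auto intro!: derivative_eq_intros simp: power2_eq_square)
  moreover have "continuous_on {..<b} \<psi>'"
    unfolding \<psi>'_def by (auto intro!: continuous_intros)
  moreover have "t < b" using t_b \<kappa> by simp
  ultimately have "\<psi>' t + G \<xi> \<le> 0"
    using yt(1) \<open>y < r\<close> t_a by (intro sub[where y = y and t = t and \<psi> = \<psi> and \<psi>' = \<psi>' and \<xi> = \<xi>])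
  moreover have "\<sigma> / (b - t)\<^sup>2 > 0" using \<sigma> t_b \<kappa> by simp
  ultimately show False using \<xi>(2) by (simp add: \<psi>'_def)
qed

section \<open>Decay without return\<close>

text \<open>Here \<open>e\<close> is a sign and \<open>k e\<close> the rate at which \<open>d\<close> loses modulus while it has that sign. Going back
  from a time with \<open>d t \<noteq> 0\<close> to the last zero \<open>a\<close> of \<open>d\<close>, the decay on the interval
  after \<open>a\<close> would keep \<open>\<bar>d\<bar>\<close> below \<open>\<bar>d a\<bar> = 0\<close>; so there is no zero, and the decay
  from time \<open>0\<close> gives the bound.\<close>

lemma no_return_extinction_bound:
  fixes d k :: "real \<Rightarrow> real"
  assumes cont: "continuous_on {0..} d" and d0: "0 < d 0" and k: "0 < k 1" "0 \<le> k (-1)"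
    and decay: "\<And>e a b t. \<lbrakk>e = 1 \<or> e = -1; 0 \<le> a; a < t; t < b; \<And>u. a < u \<Longrightarrow> u < b \<Longrightarrow> 0 < e * d u\<rbrakk>
       \<Longrightarrow> e * d t \<le> e * d a - k e * (t - a)"
    and t: "0 < t" "d t \<noteq> 0"
  shows "t \<le> d 0 / k 1"
proof (rule ccontr)
  assume far: "\<not> t \<le> d 0 / k 1"
  define e :: real where "e = sgn (d t)"
  have e: "e = 1 \<or> e = -1" "0 < e * d t" using t(2) by (auto simp: e_def sgn_if)
  \<comment> \<open>Times up to \<open>t\<close> without the sign that \<open>d\<close> has at \<open>t\<close>.\<close>
  define Z where "Z = {u \<in> {0..t}. e * d u \<le> 0}"
  have "continuous_on {0..t} (\<lambda>u. e * d u)"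
    by (intro continuous_intros continuous_on_subset[OF cont]) auto
  then have "closed Z" unfolding Z_def by (intro continuous_on_closed_Collect_le) auto
  have bdd: "bdd_above Z" by (auto simp: Z_def)
  show False
  proof (cases "Z = {}")
    case True
    then have pos: "0 < e * d u" if "0 \<le> u" "u \<le> t" for u
    proof -
      have "u \<notin> Z" using True by simp
      then show ?thesis using that by (simp add: Z_def)
    qed
    have "e = 1" using e pos[of 0] d0 t(1) by auto
    obtain s where s: "d 0 / k 1 < s" "s < t" using far dense not_le by metis
    moreover have "0 < d 0 / k 1" using d0 k by simp
    ultimately have "0 < s" by (meson order.strict_trans)
    have "1 * d s \<le> 1 * d 0 - k 1 * (s - 0)"
      by (rule decay[where b = t]) (use s \<open>0 < s\<close> pos \<open>e = 1\<close> in auto)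
    then have "d s \<le> d 0 - k 1 * s" by simp
    also have "\<dots> < 0" using s(1) k by (simp add: pos_divide_less_eq mult.commute)
    finally show False using pos[of s] s \<open>0 < s\<close> \<open>e = 1\<close> by simp
  next
    case False
    define a where "a = Sup Z"
    have "a \<in> Z" unfolding a_def by (rule closed_contains_Sup) fact+
    then have a: "0 \<le> a" "a < t" "e * d a \<le> 0" using e by (auto simp: Z_def less_le)
    have pos: "0 < e * d u" if "a < u" "u < t" for u
    proof (rule ccontr)
      assume "\<not> 0 < e * d u"
      then have "u \<in> Z" using that a by (auto simp: Z_def)
      then show False using cSup_upper[OF _ bdd, of u] that by (simp add: a_def)
    qed
    define s where "s = (a + t) / 2"
    have s: "a < s" "s < t" using a by (auto simp: s_def)
    have "e * d s \<le> e * d a - k e * (s - a)"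
      by (rule decay[where b = t]) (use a s pos e in auto)
    moreover have "0 \<le> k e * (s - a)" using e k s by auto
    ultimately show False using pos[of s] s a by simp
  qed
qed

section \<open>Traces at a jump\<close>

text \<open>\<open>Vl\<close> and \<open>Vr\<close> represent \<open>U\<close> in half-strips of width \<open>r\<close> on the two sides of \<open>c\<close>, for all
  times, and are continuous up to \<open>x = c\<close> and \<open>t = 0\<close>.\<close>

definition two_sided_traces ::
  "(real \<times> real \<Rightarrow> real) \<Rightarrow> real \<Rightarrow> real \<Rightarrow> (real \<times> real \<Rightarrow> real) \<Rightarrow> (real \<times> real \<Rightarrow> real) \<Rightarrow> bool"
  where
  "two_sided_traces U c r Vl Vr \<longleftrightarrow> 0 < r \<and>
     continuous_on ({c - r..c} \<times> {0..}) Vl \<and> continuous_on ({c..c + r} \<times> {0..}) Vr \<and>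
     (AE w in lebesgue. w \<in> {c - r<..<c} \<times> {0<..} \<longrightarrow> U w = Vl w) \<and>
     (AE w in lebesgue. w \<in> {c<..<c + r} \<times> {0<..} \<longrightarrow> U w = Vr w)"

lemma open_domain_Q: "open (domain_Q T)"
  unfolding domain_Q_def by (intro open_Times) auto

text \<open>The line \<open>x = c\<close> is null, so on it the envelopes see the two sides only; off that line
  they reproduce the continuous representative, at \<open>t = 0\<close> as well.\<close>

lemma envelopes_near_jump:
  assumes tr: "two_sided_traces U c r Vl Vr"
    and U: "U \<in> borel_measurable (lebesgue_on (domain_Q T))"
    and yt: "\<bar>y - c\<bar> < r" "0 \<le> t" "t < T"
  shows "upper_envelope (domain_Q T) U (y, t) =
      (if y < c then Vl (y, t) else if c < y then Vr (y, t) else max (Vl (c, t)) (Vr (c, t)))"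
    and "lower_envelope (domain_Q T) U (y, t) =
      (if y < c then Vl (y, t) else if c < y then Vr (y, t) else min (Vl (c, t)) (Vr (c, t)))"
proof -
  define A where "A = {c - r<..<c} \<times> {0<..<T}"
  define B where "B = {c<..<c + r} \<times> {0<..<T}"
  have r: "r > 0" using tr by (simp add: two_sided_traces_def)
  have T: "T > 0" using yt by simp
  have cl: "closure A = {c - r..c} \<times> {0..T}" "closure B = {c..c + r} \<times> {0..T}"
    using r T by (simp_all add: A_def B_def closure_Times)
  have A: "open A" "A \<subseteq> domain_Q T" "continuous_on (closure A) Vl"
    using tr unfolding cl two_sided_traces_def
    by (auto simp: A_def domain_Q_def intro!: open_Times elim!: continuous_on_subset)
  have AE_A: "AE w in lebesgue. w \<in> A \<longrightarrow> U w = Vl w"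
  proof -
    have "AE w in lebesgue. w \<in> {c - r<..<c} \<times> {0<..} \<longrightarrow> U w = Vl w"
      using tr by (simp add: two_sided_traces_def)
    then show ?thesis by eventually_elim (auto simp: A_def)
  qed
  have B: "open B" "B \<subseteq> domain_Q T" "continuous_on (closure B) Vr"
    using tr unfolding cl two_sided_traces_def
    by (auto simp: B_def domain_Q_def intro!: open_Times elim!: continuous_on_subset)
  have AE_B: "AE w in lebesgue. w \<in> B \<longrightarrow> U w = Vr w"
  proof -
    have "AE w in lebesgue. w \<in> {c<..<c + r} \<times> {0<..} \<longrightarrow> U w = Vr w"
      using tr by (simp add: two_sided_traces_def)
    then show ?thesis by eventually_elim (auto simp: B_def)
  qed
  have ball: "\<bar>fst w - y\<bar> < \<rho>" if "w \<in> ball (y, t) \<rho>" for w \<rho>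
    using that dist_fst_le[of w "(y, t)"] by (simp add: dist_real_def dist_commute)
  define \<rho> where "\<rho> = min (r - \<bar>y - c\<bar>) (if y = c then r else \<bar>y - c\<bar>)"
  have \<rho>: "\<rho> > 0" using yt r by (simp add: \<rho>_def)
  consider "y < c" | "c < y" | "y = c" by linarith
  then have "upper_envelope (domain_Q T) U (y, t) =
      (if y < c then Vl (y, t) else if c < y then Vr (y, t) else max (Vl (c, t)) (Vr (c, t))) \<and>
    lower_envelope (domain_Q T) U (y, t) =
      (if y < c then Vl (y, t) else if c < y then Vr (y, t) else min (Vl (c, t)) (Vr (c, t)))"
  proof cases
    case 1
    have "ball (y, t) \<rho> \<inter> domain_Q T - (A \<union> A) = {}"
      using 1 by (auto simp: A_def domain_Q_def \<rho>_def dest!: ball)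
    moreover have "(y, t) \<in> closure A" using yt 1 by (auto simp: cl)
    ultimately show ?thesis
      using envelopes_two_pieces[OF U open_domain_Q A(1,2) _ A(3) AE_A A(1,2) _ A(3) AE_A \<rho>] 1
      by simp
  next
    case 2
    have "ball (y, t) \<rho> \<inter> domain_Q T - (B \<union> B) = {}"
      using 2 by (auto simp: B_def domain_Q_def \<rho>_def dest!: ball)
    moreover have "(y, t) \<in> closure B" using yt 2 by (auto simp: cl)
    ultimately show ?thesis
      using envelopes_two_pieces[OF U open_domain_Q B(1,2) _ B(3) AE_B B(1,2) _ B(3) AE_B \<rho>] 2
      by simp
  next
    case 3
    have "ball (y, t) \<rho> \<inter> domain_Q T - (A \<union> B) \<subseteq> {w. w \<bullet> (1, 0) = c}"
    proof
      fix w assume "w \<in> ball (y, t) \<rho> \<inter> domain_Q T - (A \<union> B)"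
      then show "w \<in> {w. w \<bullet> (1, 0) = c}"
        using 3 ball[of w \<rho>] by (cases w) (auto simp: A_def B_def domain_Q_def \<rho>_def abs_less_iff)
    qed
    moreover have "negligible {w :: real \<times> real. w \<bullet> (1, 0) = c}"
      by (rule negligible_standard_hyperplane) (simp add: Basis_prod_def)
    ultimately have "negligible (ball (y, t) \<rho> \<inter> domain_Q T - (A \<union> B))"
      by (rule negligible_subset[rotated])
    moreover have "(y, t) \<in> closure A" "(y, t) \<in> closure B" using yt 3 r by (auto simp: cl)
    ultimately show ?thesis
      using envelopes_two_pieces[OF U open_domain_Q A(1,2) _ A(3) AE_A B(1,2) _ B(3) AE_B \<rho>] 3
      by simp
  qed
  then show "upper_envelope (domain_Q T) U (y, t) =
      (if y < c then Vl (y, t) else if c < y then Vr (y, t) else max (Vl (c, t)) (Vr (c, t)))"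
    and "lower_envelope (domain_Q T) U (y, t) =
      (if y < c then Vl (y, t) else if c < y then Vr (y, t) else min (Vl (c, t)) (Vr (c, t)))"
    by auto
qed

section \<open>Decay of the jump of a viscosity solution\<close>

text \<open>A property of the function \<open>E\<close> itself rather than of its envelope, because it is used both for
  the upper envelope and for the negative of the lower one.\<close>

definition viscosity_subsolution ::
  "(real \<Rightarrow> real) \<Rightarrow> real \<Rightarrow> (real \<times> real \<Rightarrow> real) \<Rightarrow> bool" where
  "viscosity_subsolution G T E \<longleftrightarrow>
     (\<forall>\<phi> \<phi>\<^sub>x \<phi>\<^sub>t z. C1_with_partials (domain_Q T) \<phi> \<phi>\<^sub>x \<phi>\<^sub>t \<longrightarrow>
        local_max_in (domain_Q T) (\<lambda>w. E w - \<phi> w) z \<longrightarrow> \<phi>\<^sub>t z + G (\<phi>\<^sub>x z) \<le> 0)"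

lemma viscosity_solution_imp_subsolution_upper:
  "viscosity_solution H T U \<Longrightarrow> viscosity_subsolution H T (upper_envelope (domain_Q T) U)"
  unfolding viscosity_solution_def viscosity_subsolution_def by blast

lemma viscosity_solution_imp_subsolution_lower:
  assumes "viscosity_solution H T U"
  shows "viscosity_subsolution (\<lambda>\<xi>. - H (- \<xi>)) T (\<lambda>w. - lower_envelope (domain_Q T) U w)"
  unfolding viscosity_subsolution_def
proof (intro allI impI)
  fix \<phi> \<phi>\<^sub>x \<phi>\<^sub>t z
  assume C1: "C1_with_partials (domain_Q T) \<phi> \<phi>\<^sub>x \<phi>\<^sub>t"
    and max: "local_max_in (domain_Q T) (\<lambda>w. - lower_envelope (domain_Q T) U w - \<phi> w) z"
  have "((\<lambda>w. - \<phi> w) has_derivative (\<lambda>(h, k). - \<phi>\<^sub>x z * h + - \<phi>\<^sub>t z * k)) (at z)"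
    if "z \<in> domain_Q T" for z
  proof -
    have "((\<lambda>w. - \<phi> w) has_derivative (\<lambda>v. - (case v of (h, k) \<Rightarrow> \<phi>\<^sub>x z * h + \<phi>\<^sub>t z * k))) (at z)"
      using C1 that unfolding C1_with_partials_def by (intro has_derivative_minus) auto
    then show ?thesis by (simp add: case_prod_unfold)
  qed
  then have "C1_with_partials (domain_Q T) (\<lambda>w. - \<phi> w) (\<lambda>w. - \<phi>\<^sub>x w) (\<lambda>w. - \<phi>\<^sub>t w)"
    using C1 unfolding C1_with_partials_def by (auto intro!: continuous_on_minus)
  moreover have "local_min_in (domain_Q T) (\<lambda>w. lower_envelope (domain_Q T) U w - (- \<phi> w)) z"
    using max unfolding local_max_in_def local_min_in_def by (auto simp: algebra_simps)
  ultimately have "- \<phi>\<^sub>t z + H (- \<phi>\<^sub>x z) \<ge> 0"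
    using assms unfolding viscosity_solution_def by blast
  then show "\<phi>\<^sub>t z + - H (- \<phi>\<^sub>x z) \<le> 0" by simp
qed

text \<open>The sign \<open>e\<close> tells which side carries the larger trace; reflecting \<open>x\<close> about \<open>c\<close> when
  \<open>e = -1\<close> brings that side to the right, at the price of replacing \<open>G \<xi>\<close> by \<open>G (e * \<xi>)\<close>.\<close>

lemma larger_trace_decay:
  assumes sub: "viscosity_subsolution G T E"
    and r: "0 < r" and e: "e = 1 \<or> e = -1" and \<tau>: "0 \<le> a" "a < \<tau>" "\<tau> < T"
    and Vl: "continuous_on ({c - r..c} \<times> {0..}) Vl"
    and Vr: "continuous_on ({c..c + r} \<times> {0..}) Vr"
    and E: "\<And>y t. \<bar>y - c\<bar> < r \<Longrightarrow> 0 \<le> t \<Longrightarrow> t < T \<Longrightarrow> E (y, t) =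
      (if y < c then Vl (y, t) else if c < y then Vr (y, t) else max (Vl (c, t)) (Vr (c, t)))"
    and gap: "\<And>t. a < t \<Longrightarrow> t < T \<Longrightarrow> 0 < e * (Vr (c, t) - Vl (c, t))"
    and freq: "\<And>N. \<exists>\<xi>>N. A \<le> G (e * \<xi>)"
  shows "(if e = 1 then Vr else Vl) (c, \<tau>) \<le> (if e = 1 then Vr else Vl) (c, a) - A * (\<tau> - a)"
proof -
  define high where "high = (if e = 1 then Vr else Vl)"
  define low where "low = (if e = 1 then Vl else Vr)"
  define v where "v w = high (c + e * fst w, snd w)" for w :: "real \<times> real"
  define l where "l w = low (c + e * fst w, snd w)" for w :: "real \<times> real"
  define W where "W w = (if fst w < 0 then l w else v w)" for w :: "real \<times> real"
  have ee: "e * (e * q) = q" for q :: real using e by auto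
  have v_cont: "continuous_on ({0..r} \<times> {a..T}) v"
    unfolding v_def high_def using e \<tau>
    by (auto intro!: continuous_intros continuous_on_compose2[OF Vl] continuous_on_compose2[OF Vr])
  have l_cont: "continuous_on ({-r..0} \<times> {a..T}) l"
    unfolding l_def low_def using e \<tau>
    by (auto intro!: continuous_intros continuous_on_compose2[OF Vl] continuous_on_compose2[OF Vr])
  have gap': "l (0, t) < v (0, t)" if "a < t" "t < T" for t
    using gap[OF that] e by (auto simp: l_def v_def low_def high_def)
  have EW: "E w = W (e * (fst w - c), snd w)" if "\<bar>fst w - c\<bar> < r" "a < snd w" "snd w < T" for w
  proof -
    obtain y t where w: "w = (y, t)" by fastforce
    show ?thesis using that E[of y t] gap[of t] \<tau> e
      by (auto simp: w W_def l_def v_def low_def high_def)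
  qed
  have "v (0, \<tau>) \<le> v (0, a) - A * (\<tau> - a)"
  proof (rule steep_barrier_decay[where W = W and G = "\<lambda>\<xi>. G (e * \<xi>)", OF r \<tau>(2,3) v_cont l_cont])
    show "W (y, t) = (if y < 0 then l (y, t) else v (y, t))" for y t by (simp add: W_def)
  next
    fix \<xi> y t and \<psi> \<psi>' :: "real \<Rightarrow> real"
    assume yt: "0 \<le> y" "y < r" "a < t" "t < T"
      and \<psi>: "\<And>s. s < T \<Longrightarrow> (\<psi> has_real_derivative \<psi>' s) (at s)" "continuous_on {..<T} \<psi>'"
      and max: "eventually (\<lambda>w. W w - \<xi> * fst w - \<psi> (snd w) \<le> W (y, t) - \<xi> * y - \<psi> t) (nhds (y, t))"
    define \<phi> where "\<phi> w = e * \<xi> * (fst w - c) + \<psi> (snd w)" for w :: "real \<times> real"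
    define z where "z = (c + e * y, t)"
    have "C1_with_partials (domain_Q T) \<phi> (\<lambda>w. e * \<xi>) (\<lambda>w. \<psi>' (snd w))"
      unfolding C1_with_partials_def
    proof (intro conjI ballI)
      show "continuous_on (domain_Q T) (\<lambda>w. \<psi>' (snd w))"
        by (rule continuous_on_compose2[OF \<psi>(2)]) (auto simp: domain_Q_def intro!: continuous_intros)
    next
      fix w assume "w \<in> domain_Q T"
      then have "(\<psi> has_derivative (\<lambda>k. \<psi>' (snd w) * k)) (at (snd w))"
        using \<psi>(1)[of "snd w"] by (auto simp: domain_Q_def has_field_derivative_def)
      from has_derivative_compose[OF has_derivative_snd[OF has_derivative_ident] this]
      have "((\<lambda>w. \<psi> (snd w)) has_derivative (\<lambda>v. \<psi>' (snd w) * snd v)) (at w)" .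
      then show "(\<phi> has_derivative (\<lambda>(h, k). e * \<xi> * h + \<psi>' (snd w) * k)) (at w)"
        unfolding \<phi>_def case_prod_unfold by (auto intro!: derivative_eq_intros)
    qed simp
    moreover have "local_max_in (domain_Q T) (\<lambda>w. E w - \<phi> w) z"
    proof -
      define m where "m w = (e * (fst w - c), snd w)" for w :: "real \<times> real"
      have mz: "m z = (y, t)" by (simp add: m_def z_def ee)
      have "isCont m z" unfolding m_def by (intro continuous_intros)
      then have "filterlim m (nhds (m z)) (nhds z)"
        unfolding isCont_def tendsto_at_iff_tendsto_nhds .
      then have ev: "eventually (\<lambda>w. W (m w) - \<xi> * fst (m w) - \<psi> (snd (m w))
          \<le> W (y, t) - \<xi> * y - \<psi> t) (nhds z)"
        using max unfolding filterlim_iff mz by blast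
      have z_box: "\<bar>fst z - c\<bar> < r" "a < snd z" "snd z < T" using yt e by (auto simp: z_def)
      have "open ({c - r<..<c + r} \<times> {a<..<T})" by (intro open_Times) auto
      then have "eventually (\<lambda>w. w \<in> {c - r<..<c + r} \<times> {a<..<T}) (nhds z)"
        by (rule eventually_nhds_in_open) (use z_box in \<open>auto simp: z_def abs_less_iff\<close>)
      with ev have "eventually (\<lambda>w. E w - \<phi> w \<le> E z - \<phi> z) (nhds z)"
      proof eventually_elim
        case (elim w)
        have "\<bar>fst w - c\<bar> < r" "a < snd w" "snd w < T" using elim(2) by auto
        then show ?case
          using elim(1) EW[of w] EW[of z] z_box mz
          by (simp add: m_def \<phi>_def z_def ee algebra_simps)
      qed
      then obtain \<epsilon> where "\<epsilon> > 0" "\<And>w. dist w z < \<epsilon> \<Longrightarrow> E w - \<phi> w \<le> E z - \<phi> z"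
        unfolding eventually_nhds_metric by blast
      then show ?thesis
        using yt \<tau> unfolding local_max_in_def
        by (auto simp: z_def domain_Q_def dist_commute intro!: exI[of _ \<epsilon>])
    qed
    ultimately show "\<psi>' t + G (e * \<xi>) \<le> 0"
      using sub unfolding viscosity_subsolution_def z_def by fastforce
  qed (use gap' freq in auto)
  then show ?thesis by (simp add: v_def high_def)
qed

text \<open>The larger trace is controlled by the subsolution property of the upper envelope. The smaller one
  is, up to sign, the larger trace of \<open>- U\<close>, whose jump has the opposite sign \<open>- e\<close> and whose
  Hamiltonian is \<open>- H (- \<xi>)\<close>; since \<open>- H (- (- e * \<xi>)) = - H (e * \<xi>)\<close>, both estimates probe \<open>H\<close> in the
  same direction.\<close>

lemma jump_decay:
  assumes sol: "viscosity_solution H T U" and tr: "two_sided_traces U c r Vl Vr"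
    and e: "e = 1 \<or> e = -1" and \<tau>: "0 \<le> a" "a < \<tau>" "\<tau> < T"
    and gap: "\<And>t. a < t \<Longrightarrow> t < T \<Longrightarrow> 0 < e * (Vr (c, t) - Vl (c, t))"
    and sup: "\<And>A N. A < M \<Longrightarrow> \<exists>\<xi>>N. A \<le> H (e * \<xi>)"
    and inf: "\<And>B N. m < B \<Longrightarrow> \<exists>\<xi>>N. H (e * \<xi>) \<le> B"
  shows "e * (Vr (c, \<tau>) - Vl (c, \<tau>)) \<le> e * (Vr (c, a) - Vl (c, a)) - (M - m) * (\<tau> - a)"
proof (rule field_le_epsilon)
  fix \<epsilon> :: real assume \<epsilon>: "\<epsilon> > 0"
  define \<eta> where "\<eta> = \<epsilon> / (2 * (\<tau> - a))"
  have \<eta>: "\<eta> > 0" "2 * \<eta> * (\<tau> - a) = \<epsilon>" using \<epsilon> \<tau> by (simp_all add: \<eta>_def divide_simps)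
  have r: "0 < r" and Vl: "continuous_on ({c - r..c} \<times> {0..}) Vl"
    and Vr: "continuous_on ({c..c + r} \<times> {0..}) Vr"
    using tr by (auto simp: two_sided_traces_def)
  have "U \<in> borel_measurable (lebesgue_on (closure (domain_Q T)))"
    using sol by (simp add: viscosity_solution_def Linfty_loc_def)
  then have U: "U \<in> borel_measurable (lebesgue_on (domain_Q T))"
    by (rule measurable_restrict_mono) (rule closure_subset)
  note env = envelopes_near_jump[OF tr U]
  \<comment> \<open>The bounds \<open>M\<close> and \<open>m\<close> need not be reached by \<open>H\<close>, hence the margin \<open>\<eta>\<close>.\<close>
  have "(if e = 1 then Vr else Vl) (c, \<tau>)
      \<le> (if e = 1 then Vr else Vl) (c, a) - (M - \<eta>) * (\<tau> - a)"
    by (rule larger_trace_decay[OF viscosity_solution_imp_subsolution_upper[OF sol] r e \<tau> Vl Vr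
          env(1) gap sup]) (use \<eta> in auto)
  moreover have "(if - e = 1 then \<lambda>w. - Vr w else (\<lambda>w. - Vl w)) (c, \<tau>)
      \<le> (if - e = 1 then \<lambda>w. - Vr w else (\<lambda>w. - Vl w)) (c, a) - (- (m + \<eta>)) * (\<tau> - a)"
  proof (rule larger_trace_decay[OF viscosity_solution_imp_subsolution_lower[OF sol] r _ \<tau>])
    show "- e = 1 \<or> - e = - 1" using e by auto
    show "continuous_on ({c - r..c} \<times> {0..}) (\<lambda>w. - Vl w)"
      "continuous_on ({c..c + r} \<times> {0..}) (\<lambda>w. - Vr w)"
      by (intro continuous_on_minus Vl Vr)+
    show "- lower_envelope (domain_Q T) U (y, t) = (if y < c then - Vl (y, t)
        else if c < y then - Vr (y, t) else max (- Vl (c, t)) (- Vr (c, t)))"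
      if "\<bar>y - c\<bar> < r" "0 \<le> t" "t < T" for y t
      using env(2)[OF that] by (auto simp: max_def min_def)
    show "0 < - e * (- Vr (c, t) - - Vl (c, t))" if "a < t" "t < T" for t
      using gap[OF that] by (simp add: algebra_simps)
    show "\<exists>\<xi>>N. - (m + \<eta>) \<le> - H (- (- e * \<xi>))" for N
      using inf[of "m + \<eta>" N] \<eta> by auto
  qed
  ultimately show "e * (Vr (c, \<tau>) - Vl (c, \<tau>))
      \<le> e * (Vr (c, a) - Vl (c, a)) - (M - m) * (\<tau> - a) + \<epsilon>"
    using e \<eta>(2) by (auto simp: algebra_simps)
qed

section \<open>The initial jump and the traces of a solution\<close>

text \<open>On the open interval a continuous representative coincides with the envelope; continuity carries
  the equality to the end points, where the envelope itself may take the larger value from beyond.\<close>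

lemma continuous_representative_eq_upper_envelope:
  fixes \<alpha> \<beta> :: real
  assumes f: "f \<in> borel_measurable (lebesgue_on UNIV)" and "\<alpha> < \<beta>"
    and g: "continuous_on {\<alpha>..\<beta>} g" "AE y in lebesgue. y \<in> {\<alpha><..<\<beta>} \<longrightarrow> f y = g y"
    and h: "continuous_on {\<alpha>..\<beta>} h" "\<And>y. y \<in> {\<alpha><..<\<beta>} \<Longrightarrow> upper_envelope UNIV f y = h y"
    and y: "y \<in> {\<alpha>..\<beta>}"
  shows "g y = h y"
proof -
  have cl: "closure {\<alpha><..<\<beta>} = {\<alpha>..\<beta>}" using \<open>\<alpha> < \<beta>\<close> by simp
  have zero: "g q - h q = 0" if q: "q \<in> {\<alpha><..<\<beta>}" for q
  proof -
    define \<rho> where "\<rho> = min (q - \<alpha>) (\<beta> - q)"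
    have "ball q \<rho> \<inter> UNIV - ({\<alpha><..<\<beta>} \<union> {\<alpha><..<\<beta>}) = {}"
      by (auto simp: \<rho>_def dist_real_def)
    then have "upper_envelope UNIV f q = max (g q) (g q)"
      using q g cl
      by (intro envelopes_two_pieces[where A = "{\<alpha><..<\<beta>}" and B = "{\<alpha><..<\<beta>}" and \<rho> = \<rho>, OF f])
        (auto simp: \<rho>_def)
    then show ?thesis using h(2)[OF q] by simp
  qed
  have "continuous_on (closure {\<alpha><..<\<beta>}) (\<lambda>q. g q - h q)"
    unfolding cl by (intro continuous_intros g h)
  then have "g y - h y = 0"
    by (rule continuous_constant_on_closure[where f = "\<lambda>q. g q - h q"]) (use zero y cl in auto)
  then show ?thesis by simp
qed

text \<open>Near \<open>c\<close>, but off \<open>c\<close>, the initial condition equates the representatives of any admissible partition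
  with the traces of the solution at time \<open>0\<close>. The common one-sided limits at \<open>c\<close> are
  therefore independent of the partition, which is the uniqueness required by the definite
  descriptions behind \<open>initial_jump\<close>.\<close>

lemma initial_jump_eq_trace_difference:
  assumes tr: "two_sided_traces U c r Vl Vr"
    and U: "U \<in> borel_measurable (lebesgue_on (domain_Q T))" and T: "0 < T"
    and U0: "U0 \<in> borel_measurable (lebesgue_on UNIV)"
    and init: "\<And>y. upper_envelope (domain_Q T) U (y, 0) = upper_envelope UNIV U0 y"
    and c: "c \<in> discontinuities U0"
  shows "initial_jump U0 c = Vr (c, 0) - Vl (c, 0)"
proof -
  have r: "0 < r" and Vl: "continuous_on ({c - r..c} \<times> {0..}) Vl"
    and Vr: "continuous_on ({c..c + r} \<times> {0..}) Vr"
    using tr by (auto simp: two_sided_traces_def)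
  have traces: "(g k \<longlongrightarrow> Vl (c, 0)) (at_left c)" "(g (k + 1) \<longlongrightarrow> Vr (c, 0)) (at_right c)"
    if "pc_partition U0 a b n q g" and k: "k \<in> {1..n}" "c = q k" for a b n q g k
  proof -
    have P: "q (i - 1) < q i" "continuous_on {q (i - 1)..q i} (g i)"
      "AE y in lebesgue_on {q (i - 1)<..<q i}. U0 y = g i y" if "i \<in> {1..n + 1}" for i
      using \<open>pc_partition U0 a b n q g\<close> that unfolding pc_partition_def by blast+
    have AE: "AE y in lebesgue. y \<in> {q (i - 1)<..<q i} \<longrightarrow> U0 y = g i y" if "i \<in> {1..n + 1}" for i
      using P(3)[OF that] by (simp add: AE_restrict_space_iff)
    have k1: "k \<in> {1..n + 1}" "k + 1 \<in> {1..n + 1}" using k by auto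
    note L = P(1,2)[OF k1(1)] AE[OF k1(1)] and R = P(1,2)[OF k1(2)] AE[OF k1(2)]
    define \<alpha> where "\<alpha> = max (q (k - 1)) (c - r)"
    define \<beta> where "\<beta> = min (q (k + 1)) (c + r)"
    have "g k c = Vl (c, 0)"
    proof (rule continuous_representative_eq_upper_envelope[OF U0, where \<alpha> = \<alpha> and \<beta> = c
          and g = "g k" and h = "\<lambda>y. Vl (y, 0)" and y = c])
      show "\<alpha> < c" using L r k by (auto simp: \<alpha>_def)
      then show "c \<in> {\<alpha>..c}" by simp
      show "continuous_on {\<alpha>..c} (g k)"
        by (rule continuous_on_subset[OF L(2)]) (auto simp: \<alpha>_def k)
      show "AE y in lebesgue. y \<in> {\<alpha><..<c} \<longrightarrow> U0 y = g k y"
        using L(3) by eventually_elim (auto simp: \<alpha>_def k)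
      show "continuous_on {\<alpha>..c} (\<lambda>y. Vl (y, 0))"
        by (rule continuous_on_compose2[OF Vl]) (auto simp: \<alpha>_def intro!: continuous_intros)
      show "upper_envelope UNIV U0 y = Vl (y, 0)" if "y \<in> {\<alpha><..<c}" for y
        using envelopes_near_jump(1)[OF tr U, of y 0] that T init[of y] by (auto simp: \<alpha>_def)
    qed
    moreover have "(g k \<longlongrightarrow> g k (q k)) (at_left (q k))"
      using L by (intro continuous_on_Icc_at_leftD)
    ultimately show "(g k \<longlongrightarrow> Vl (c, 0)) (at_left c)" using k by simp
    have "g (k + 1) c = Vr (c, 0)"
    proof (rule continuous_representative_eq_upper_envelope[OF U0, where \<alpha> = c and \<beta> = \<beta>
          and g = "g (k + 1)" and h = "\<lambda>y. Vr (y, 0)" and y = c])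
      show "c < \<beta>" using R r k by (auto simp: \<beta>_def)
      then show "c \<in> {c..\<beta>}" by simp
      show "continuous_on {c..\<beta>} (g (k + 1))"
        by (rule continuous_on_subset[OF R(2)]) (auto simp: \<beta>_def k)
      show "AE y in lebesgue. y \<in> {c<..<\<beta>} \<longrightarrow> U0 y = g (k + 1) y"
        using R(3) by eventually_elim (auto simp: \<beta>_def k)
      show "continuous_on {c..\<beta>} (\<lambda>y. Vr (y, 0))"
        by (rule continuous_on_compose2[OF Vr]) (auto simp: \<beta>_def intro!: continuous_intros)
      show "upper_envelope UNIV U0 y = Vr (y, 0)" if "y \<in> {c<..<\<beta>}" for y
        using envelopes_near_jump(1)[OF tr U, of y 0] that T init[of y] by (auto simp: \<beta>_def)
    qed
    moreover have "(g (k + 1) \<longlongrightarrow> g (k + 1) (q (k + 1 - 1))) (at_right (q (k + 1 - 1)))"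
      using R by (intro continuous_on_Icc_at_rightD)
    ultimately show "(g (k + 1) \<longlongrightarrow> Vr (c, 0)) (at_right c)" using k by simp
  qed
  obtain a b n q g k where part: "pc_partition U0 a b n q g" "k \<in> {1..n}" "c = q k"
    using c unfolding discontinuities_def by blast
  have "limit_left U0 c = Vl (c, 0)"
    unfolding limit_left_def
  proof (rule the_equality)
    show "\<exists>a b n q g. pc_partition U0 a b n q g \<and>
        (\<exists>j\<in>{1..n}. c = q j \<and> (g j \<longlongrightarrow> Vl (c, 0)) (at_left c))"
      using part traces(1)[OF part] by blast
  next
    fix v assume "\<exists>a b n q g. pc_partition U0 a b n q g \<and>
        (\<exists>j\<in>{1..n}. c = q j \<and> (g j \<longlongrightarrow> v) (at_left c))"
    then obtain a b n q g j where *: "pc_partition U0 a b n q g" "j \<in> {1..n}" "c = q j"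
      and v: "(g j \<longlongrightarrow> v) (at_left c)" by blast
    show "v = Vl (c, 0)"
      by (rule tendsto_unique[OF _ v traces(1)[OF *]]) simp
  qed
  moreover have "limit_right U0 c = Vr (c, 0)"
    unfolding limit_right_def
  proof (rule the_equality)
    show "\<exists>a b n q g. pc_partition U0 a b n q g \<and>
        (\<exists>j\<in>{1..n}. c = q j \<and> (g (j + 1) \<longlongrightarrow> Vr (c, 0)) (at_right c))"
      using part traces(2)[OF part] by blast
  next
    fix v assume "\<exists>a b n q g. pc_partition U0 a b n q g \<and>
        (\<exists>j\<in>{1..n}. c = q j \<and> (g (j + 1) \<longlongrightarrow> v) (at_right c))"
    then obtain a b n q g j where *: "pc_partition U0 a b n q g" "j \<in> {1..n}" "c = q j"
      and v: "(g (j + 1) \<longlongrightarrow> v) (at_right c)" by blast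
    show "v = Vr (c, 0)"
      by (rule tendsto_unique[OF _ v traces(2)[OF *]]) simp
  qed
  ultimately show ?thesis by (simp add: initial_jump_def)
qed

lemma continuous_representatives_imp_traces:
  assumes x: "strict_mono_on {1..p} x" and j: "j \<in> {1..p}"
    and V: "\<forall>i\<in>{1..p + 1}. continuous_representative (strip p x i) U (V i)"
  obtains r where "two_sided_traces U (x j) r (V j) (V (j + 1))"
proof -
  define r where "r = min (if j = 1 then 1 else x j - x (j - 1)) (if j = p then 1 else x (j + 1) - x j)"
  have "x (j - 1) < x j" if "j \<noteq> 1"
    using that j by (intro strict_mono_onD[OF x]) auto
  moreover have "x j < x (j + 1)" if "j \<noteq> p"
    using that j by (intro strict_mono_onD[OF x]) auto
  ultimately have r: "0 < r" by (auto simp: r_def)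
  have sub: "{x j - r<..<x j} \<times> {0<..} \<subseteq> strip p x j"
    "{x j<..<x j + r} \<times> {0<..} \<subseteq> strip p x (j + 1)"
    using j by (auto simp: strip_def r_def split: if_splits)
  have cl: "{x j - r..x j} \<times> {0..} \<subseteq> closure (strip p x j)"
    "{x j..x j + r} \<times> {0..} \<subseteq> closure (strip p x (j + 1))"
    using closure_mono[OF sub(1)] closure_mono[OF sub(2)] r by (simp_all add: closure_Times)
  have V': "continuous_on (closure (strip p x i)) (V i) \<and>
      (AE w in lebesgue. w \<in> strip p x i \<longrightarrow> U w = V i w)" if i: "i \<in> {1..p + 1}" for i
  proof -
    have "strip p x i = ((if i \<noteq> 1 then {x (i - 1)<..} else UNIV) \<inter>
        (if i \<noteq> p + 1 then {..<x i} else UNIV)) \<times> {0<..}"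
      by (auto simp: strip_def split: if_splits)
    moreover have "open \<dots>" by (intro open_Times open_Int) auto
    ultimately have "strip p x i \<in> sets lebesgue" by simp
    then show ?thesis
      using bspec[OF V i] unfolding continuous_representative_def
      by (simp add: AE_restrict_space_iff)
  qed
  note V' = V'[THEN conjunct1] V'[THEN conjunct2]
  have jj: "j \<in> {1..p + 1}" "j + 1 \<in> {1..p + 1}" using j by auto
  have "two_sided_traces U (x j) r (V j) (V (j + 1))"
    unfolding two_sided_traces_def
  proof (intro conjI r)
    show "continuous_on ({x j - r..x j} \<times> {0..}) (V j)"
      by (rule continuous_on_subset[OF V'(1)[OF jj(1)] cl(1)])
    show "continuous_on ({x j..x j + r} \<times> {0..}) (V (j + 1))"
      by (rule continuous_on_subset[OF V'(1)[OF jj(2)] cl(2)])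
    show "AE w in lebesgue. w \<in> {x j - r<..<x j} \<times> {0<..} \<longrightarrow> U w = V j w"
      using V'(2)[OF jj(1)] by eventually_elim (use sub(1) in blast)
    show "AE w in lebesgue. w \<in> {x j<..<x j + r} \<times> {0<..} \<longrightarrow> U w = V (j + 1) w"
      using V'(2)[OF jj(2)] by eventually_elim (use sub(2) in blast)
  qed
  then show ?thesis by (rule that)
qed

section \<open>Finite limits of the Hamiltonian\<close>

text \<open>Boundedness makes the limits of \<open>H\<close> at \<open>\<plusminus>\<infinity>\<close> finite, so that their differences are
  real numbers.\<close>

lemma continuous_Linfty_imp_bounded:
  fixes H :: "real \<Rightarrow> real"
  assumes "Linfty UNIV H" and "continuous_on UNIV H"
  obtains C where "\<And>\<xi>. \<bar>H \<xi>\<bar> \<le> C"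
proof -
  obtain C where C: "AE \<xi> in lebesgue. \<bar>H \<xi>\<bar> \<le> C"
    using assms(1) unfolding Linfty_def by (auto simp: AE_restrict_space_iff)
  have "open {\<xi>. C < \<bar>H \<xi>\<bar>}"
    by (intro open_Collect_less continuous_intros assms(2))
  moreover have "AE \<xi> in lebesgue. \<xi> \<notin> {\<xi>. C < \<bar>H \<xi>\<bar>}"
    using C by eventually_elim auto
  ultimately have "{\<xi>. C < \<bar>H \<xi>\<bar>} = {}" by (rule open_AE_notin_imp_empty)
  then have "\<bar>H \<xi>\<bar> \<le> C" for \<xi> by (auto simp: not_less)
  then show ?thesis by (rule that)
qed

lemma Limsup_Liminf_bounded_real:
  fixes f :: "'a \<Rightarrow> real"
  assumes C: "\<And>q. \<bar>f q\<bar> \<le> C" and F: "F \<noteq> bot"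
  obtains M m where "Limsup F (\<lambda>q. ereal (f q)) = ereal M" "Liminf F (\<lambda>q. ereal (f q)) = ereal m"
    "m \<le> M" "\<And>A. A < M \<Longrightarrow> frequently (\<lambda>q. A \<le> f q) F"
    "\<And>B. m < B \<Longrightarrow> frequently (\<lambda>q. f q \<le> B) F"
proof -
  have "- C \<le> f q" "f q \<le> C" for q using C[of q] by auto
  then have "Limsup F (\<lambda>q. ereal (f q)) \<le> ereal C" "ereal (- C) \<le> Liminf F (\<lambda>q. ereal (f q))"
    by (auto intro!: Limsup_bounded Liminf_bounded)
  moreover have le: "Liminf F (\<lambda>q. ereal (f q)) \<le> Limsup F (\<lambda>q. ereal (f q))"
    by (rule Liminf_le_Limsup[OF F])
  ultimately obtain M m where
    M: "Limsup F (\<lambda>q. ereal (f q)) = ereal M" and m: "Liminf F (\<lambda>q. ereal (f q)) = ereal m"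
    by (cases "Limsup F (\<lambda>q. ereal (f q))"; cases "Liminf F (\<lambda>q. ereal (f q))") auto
  have "frequently (\<lambda>q. A \<le> f q) F" if "A < M" for A
  proof (rule ccontr)
    assume "\<not> ?thesis"
    then have "eventually (\<lambda>q. ereal (f q) \<le> ereal A) F"
      by (auto simp: not_frequently elim!: eventually_mono)
    then have "Limsup F (\<lambda>q. ereal (f q)) \<le> ereal A" by (rule Limsup_bounded)
    then show False using M that by simp
  qed
  moreover have "frequently (\<lambda>q. f q \<le> B) F" if "m < B" for B
  proof (rule ccontr)
    assume "\<not> ?thesis"
    then have "eventually (\<lambda>q. ereal B \<le> ereal (f q)) F"
      by (auto simp: not_frequently elim!: eventually_mono)
    then have "ereal B \<le> Liminf F (\<lambda>q. ereal (f q))" by (rule Liminf_bounded)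
    then show False using m that by simp
  qed
  ultimately show ?thesis using M m le by (intro that) auto
qed

section \<open>The bound on the waiting time\<close>

lemma waiting_time_le:
  assumes "\<And>t. 0 < t \<Longrightarrow> jump V x j t \<noteq> 0 \<Longrightarrow> t \<le> D / (M - m)" "m < M"
  shows "waiting_time V x j \<le> ereal D / (ereal M - ereal m)"
  using assms unfolding waiting_time_def by (auto intro!: Sup_least)

theorem theorem4p4:
  fixes H U0 :: "real \<Rightarrow> real"
    and U :: "real \<times> real \<Rightarrow> real"
    and V :: "nat \<Rightarrow> real \<times> real \<Rightarrow> real"
    and p j :: nat
    and x :: "nat \<Rightarrow> real"
  assumes "W1infty H" and "continuous_on UNIV H"
    and "Linfty_loc UNIV U0" and "piecewise_continuous U0"
    and "strict_mono_on {1..p} x" and "discontinuities U0 = x ` {1..p}"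
    and "global_viscosity_solution H U0 U"
    and "\<forall>i\<in>{1..p + 1}. continuous_representative (strip p x i) U (V i)"
    and "j \<in> {1..p}"
  shows "(initial_jump U0 (x j) > 0 \<and>
            Limsup at_top (\<lambda>\<xi>. ereal (H \<xi>)) > Liminf at_top (\<lambda>\<xi>. ereal (H \<xi>)) \<longrightarrow>
          waiting_time V x j \<le> ereal (initial_jump U0 (x j)) /
            (Limsup at_top (\<lambda>\<xi>. ereal (H \<xi>)) - Liminf at_top (\<lambda>\<xi>. ereal (H \<xi>)))) \<and>
         (initial_jump U0 (x j) < 0 \<and>
            Limsup at_bot (\<lambda>\<xi>. ereal (H \<xi>)) > Liminf at_bot (\<lambda>\<xi>. ereal (H \<xi>)) \<longrightarrow>
          waiting_time V x j \<le> ereal \<bar>initial_jump U0 (x j)\<bar> /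
            (Limsup at_bot (\<lambda>\<xi>. ereal (H \<xi>)) - Liminf at_bot (\<lambda>\<xi>. ereal (H \<xi>))))"
proof -
  obtain r where tr: "two_sided_traces U (x j) r (V j) (V (j + 1))"
    using continuous_representatives_imp_traces assms(5,8,9) by blast
  have sol: "viscosity_solution H T U" if "0 < T" for T
    using assms(7) that by (simp add: global_viscosity_solution_def viscosity_solution_Cauchy_def)
  have init: "upper_envelope (domain_Q 1) U (y, 0) = upper_envelope UNIV U0 y" for y
    using assms(7) by (simp add: global_viscosity_solution_def viscosity_solution_Cauchy_def)
  have "U \<in> borel_measurable (lebesgue_on (closure (domain_Q 1)))"
    using sol[of 1] by (simp add: viscosity_solution_def Linfty_loc_def)
  then have "U \<in> borel_measurable (lebesgue_on (domain_Q 1))"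
    by (rule measurable_restrict_mono) (rule closure_subset)
  then have J0: "initial_jump U0 (x j) = jump V x j 0"
    unfolding jump_def using assms(3,6,9) init
    by (intro initial_jump_eq_trace_difference[OF tr _ zero_less_one]) (auto simp: Linfty_loc_def)
  define J where "J = jump V x j"
  have J_cont: "continuous_on {0..} J"
  proof -
    have "continuous_on ({x j - r..x j} \<times> {0..}) (V j)" "continuous_on ({x j..x j + r} \<times> {0..}) (V (j + 1))"
      "0 < r"
      using tr by (auto simp: two_sided_traces_def)
    then show ?thesis
      unfolding J_def jump_def
      by (intro continuous_on_diff; elim continuous_on_compose2) (auto intro!: continuous_intros)
  qed
  have "Linfty UNIV H" using assms(1) by (simp add: W1infty_def)
  then obtain C where C: "\<And>\<xi>. \<bar>H \<xi>\<bar> \<le> C"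
    using continuous_Linfty_imp_bounded assms(2) by blast
  obtain Mp mp where
    top: "Limsup at_top (\<lambda>\<xi>. ereal (H \<xi>)) = ereal Mp" "Liminf at_top (\<lambda>\<xi>. ereal (H \<xi>)) = ereal mp"
    "mp \<le> Mp" "\<And>A. A < Mp \<Longrightarrow> frequently (\<lambda>\<xi>. A \<le> H \<xi>) at_top"
    "\<And>B. mp < B \<Longrightarrow> frequently (\<lambda>\<xi>. H \<xi> \<le> B) at_top"
    by (rule Limsup_Liminf_bounded_real[of H, OF C trivial_limit_at_top_linorder]) blast
  obtain Mn mn where
    bot: "Limsup at_bot (\<lambda>\<xi>. ereal (H \<xi>)) = ereal Mn" "Liminf at_bot (\<lambda>\<xi>. ereal (H \<xi>)) = ereal mn"
    "mn \<le> Mn" "\<And>A. A < Mn \<Longrightarrow> frequently (\<lambda>\<xi>. A \<le> H \<xi>) at_bot"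
    "\<And>B. mn < B \<Longrightarrow> frequently (\<lambda>\<xi>. H \<xi> \<le> B) at_bot"
    by (rule Limsup_Liminf_bounded_real[of H, OF C trivial_limit_at_bot_linorder]) blast
  \<comment> \<open>For a jump of sign \<open>e\<close> the slopes involved tend to \<open>e \<infinity>\<close>.\<close>
  define k where "k e = (if e = 1 then Mp - mp else Mn - mn)" for e :: real
  have pos: "\<exists>\<xi>>N. P (1 * \<xi>)" if P: "frequently P at_top" for P :: "real \<Rightarrow> bool" and N
    using frequently_ex[OF frequently_eventually_frequently[OF P eventually_gt_at_top[of N]]]
    by auto
  have neg: "\<exists>\<xi>>N. P (- 1 * \<xi>)" if P: "frequently P at_bot" for P :: "real \<Rightarrow> bool" and N
  proof -
    obtain \<xi> where "P \<xi>" "\<xi> < - N"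
      using frequently_ex[OF frequently_eventually_frequently[OF P eventually_gt_at_bot[of "- N"]]]
      by blast
    then show ?thesis by (intro exI[of _ "- \<xi>"]) auto
  qed
  have decay: "e * J t \<le> e * J a - k e * (t - a)"
    if e: "e = 1 \<or> e = -1" and t: "0 \<le> a" "a < t" "t < b"
      and gap: "\<And>u. a < u \<Longrightarrow> u < b \<Longrightarrow> 0 < e * J u" for e a b t
    using e
  proof
    assume [simp]: "e = 1"
    have "1 * (V (j + 1) (x j, t) - V j (x j, t))
        \<le> 1 * (V (j + 1) (x j, a) - V j (x j, a)) - (Mp - mp) * (t - a)"
    proof (rule jump_decay[OF sol[of b] tr _ t])
      show "\<exists>\<xi>>N. A \<le> H (1 * \<xi>)" if "A < Mp" for A N
        using pos[OF top(4)[OF that]] .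
      show "\<exists>\<xi>>N. H (1 * \<xi>) \<le> B" if "mp < B" for B N
        using pos[OF top(5)[OF that]] .
    qed (use t gap in \<open>auto simp: J_def jump_def\<close>)
    then show ?thesis by (simp add: J_def jump_def k_def)
  next
    assume [simp]: "e = -1"
    have "-1 * (V (j + 1) (x j, t) - V j (x j, t))
        \<le> -1 * (V (j + 1) (x j, a) - V j (x j, a)) - (Mn - mn) * (t - a)"
    proof (rule jump_decay[OF sol[of b] tr _ t])
      show "\<exists>\<xi>>N. A \<le> H (- 1 * \<xi>)" if "A < Mn" for A N
        using neg[OF bot(4)[OF that]] .
      show "\<exists>\<xi>>N. H (- 1 * \<xi>) \<le> B" if "mn < B" for B N
        using neg[OF bot(5)[OF that]] .
    qed (use t gap in \<open>auto simp: J_def jump_def\<close>)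
    then show ?thesis by (simp add: J_def jump_def k_def)
  qed
  \<comment> \<open>Multiplying by the sign \<open>s\<close> of the initial jump reduces both cases to a positive one.\<close>
  have bound: "t \<le> s * J 0 / k s"
    if s: "s = 1 \<or> s = -1" "0 < s * J 0" "0 < k s" and t: "0 < t" "J t \<noteq> 0" for s t
  proof (rule no_return_extinction_bound[where d = "\<lambda>t. s * J t" and k = "\<lambda>e. k (s * e)", simplified])
    show "continuous_on {0..} (\<lambda>t. s * J t)" by (intro continuous_intros J_cont)
    show "0 \<le> k (- s)" using top(3) bot(3) s by (auto simp: k_def)
    show "e * (s * J t) \<le> e * (s * J a) - k (s * e) * (t - a)"
      if "e = 1 \<or> e = - 1" "0 \<le> a" "a < t" "t < b" "\<And>u. a < u \<Longrightarrow> u < b \<Longrightarrow> 0 < e * (s * J u)"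
      for e a b t
      using decay[of "s * e" a t b] that s by (auto simp: mult_ac)
  qed (use s t in auto)
  have "waiting_time V x j \<le> ereal (J 0) / (ereal Mp - ereal mp)" if "0 < J 0" "mp < Mp"
    using bound[of 1] that by (intro waiting_time_le) (auto simp: k_def J_def)
  moreover have "waiting_time V x j \<le> ereal \<bar>J 0\<bar> / (ereal Mn - ereal mn)" if "J 0 < 0" "mn < Mn"
    using bound[of "-1"] that by (intro waiting_time_le) (auto simp: k_def J_def)
  ultimately show ?thesis unfolding J0 top bot J_def by simp
qed

end
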